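(* For each positive integer $n$ let $Q_1$ be the transition matrix of the randomized shift-register chain on $\{0,1\}^n$ (one step: add an independent uniform random bit mod $2$ at a uniformly random coordinate, then apply the shift register $f$), let $\pi$ be the uniform distribution on $\{0,1\}^n$, and let $d_n(t)=\max_{x\in\{0,1\}^n}\|Q_1^t(x,\cdot)-\pi\|_{\mathrm{TV}}$. Then: (i) For every $n\ge 5$, $$d_n(n+1)\le \frac{2}{n}.$$ (ii) For every $\alpha$ with $1/2<\alpha<1$, setting $t_n=\lfloor n-n^{\alpha}\rfloor$, $$d_n(t_n)\ \ge\ \|Q_1^{t_n}(\mathbf 0,\cdot)-\pi\|_{\mathrm{TV}}\ \ge\ 1-o(1)\qquad (n\to\infty),$$ where $\mathbf 0=(0,\dots,0)$. Consequently, the sequence of chains has a cutoff at time $n$ with a window of size at most $n^{1/2+\delta}$ for any $\delta>0$; that is, for every $\delta>0$ there is a sequence of positive integers $w_n\le n^{1/2+\delta}$ with $w_n=o(n)$ such that $$\limsup_{n\to\infty} d_n(n+w_n)=0\quad\text{and}\quad \liminf_{n\to\infty} d_n(n-w_n)=1 .$$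
   Context: The shift register $f:\{0,1\}^n\to\{0,1\}^n$ is $f(x_1,\dots,x_n)=(x_2,\dots,x_n,\ x_1\oplus x_2\oplus\cdots\oplus x_n)$, where $\oplus$ is addition mod $2$. Let $P$ be the transition matrix of the lazy random walk on $\{0,1\}^n$: from $x$, choose a coordinate $i\in\{1,\dots,n\}$ uniformly at random and an independent random bit $R$, uniform on $\{0,1\}$, and move to $x'=(x_1,\dots,x_i\oplus R,\dots,x_n)$. Let $\Pi$ be the permutation matrix of $f$: $\Pi_{x,y}=1$ if $y=f(x)$ and $0$ otherwise. Then $Q_1=P\Pi$, i.e. one step of $Q_1$ is $x\mapsto x'\mapsto f(x')$. The total variation distance is $\|\mu-\nu\|_{\mathrm{TV}}=\max_{B}|\mu(B)-\nu(B)|$, the maximum being over subsets $B$ of $\{0,1\}^n$. The expression $d_n(n-w_n)$ is only required to make sense for all sufficiently large $n$. *)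

theory Defs
  imports
    "HOL-Library.Z2"
    "HOL-Library.Landau_Symbols"
    "HOL-Probability.Probability"
begin

text \<open>
  Points of \<open>{0,1}\<^sup>n\<close> are lists of length \<open>n\<close> over the two-element field \<open>bit\<close>, whose
  addition is addition mod 2. Coordinates are numbered \<open>0, \<dots>, n - 1\<close>.
\<close>

type_synonym matrix = "bit list \<Rightarrow> bit list \<Rightarrow> real"

definition cube :: "nat \<Rightarrow> bit list set" where
  "cube n = {x. length x = n}"

definition shift :: "bit list \<Rightarrow> bit list" where
  "shift x = tl x @ [sum_list x]"

definition lazy_step :: "nat \<Rightarrow> bit list \<Rightarrow> bit list pmf" where
  "lazy_step n x =
     map_pmf (\<lambda>(i, R). x[i := x ! i + R])
       (pair_pmf (pmf_of_set {..<n}) (pmf_of_set {0, 1}))"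

definition lazy_walk :: "nat \<Rightarrow> matrix" where
  "lazy_walk n x y = pmf (lazy_step n x) y"

definition shift_matrix :: matrix where
  "shift_matrix x y = (if y = shift x then 1 else 0)"

text \<open>
  Matrices are indexed by \<open>cube n\<close>; only the entries with both indices in \<open>cube n\<close> matter.
\<close>

definition mat_mult :: "nat \<Rightarrow> matrix \<Rightarrow> matrix \<Rightarrow> matrix" where
  "mat_mult n A B x y = (\<Sum>z\<in>cube n. A x z * B z y)"

primrec mat_power :: "nat \<Rightarrow> matrix \<Rightarrow> nat \<Rightarrow> matrix" where
  "mat_power n A 0 = (\<lambda>x y. if x = y then 1 else 0)"
| "mat_power n A (Suc t) = mat_mult n (mat_power n A t) A"

definition Q1 :: "nat \<Rightarrow> matrix" where
  "Q1 n = mat_mult n (lazy_walk n) shift_matrix"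

definition unif :: "nat \<Rightarrow> bit list \<Rightarrow> real" where
  "unif n = pmf (pmf_of_set (cube n))"

definition tv_dist :: "nat \<Rightarrow> (bit list \<Rightarrow> real) \<Rightarrow> (bit list \<Rightarrow> real) \<Rightarrow> real" where
  "tv_dist n \<mu> \<nu> = Max ((\<lambda>B. \<bar>sum \<mu> B - sum \<nu> B\<bar>) ` Pow (cube n))"

definition tv_from :: "nat \<Rightarrow> nat \<Rightarrow> bit list \<Rightarrow> real" where
  "tv_from n t x = tv_dist n (mat_power n (Q1 n) t x) (unif n)"

definition d :: "nat \<Rightarrow> nat \<Rightarrow> real" where
  "d n t = Max (tv_from n t ` cube n)"

end

theory Submission
  imports Defs "HOL-Real_Asymp.Real_Asymp"
begin

text \<open>
  Append to a state \<open>x\<close> the parity of its entries. The resulting word of length \<open>n + 1\<close> has even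
  weight, and the shift register rotates it by one place. So the register has period \<open>n + 1\<close>, and
  adding a random bit at coordinate \<open>i\<close> of \<open>x\<close> adds it at two places of the word: at \<open>i\<close> and at the
  last place. The characters of \<open>{0,1}\<^sup>n\<close> are the products of signs over sets \<open>A\<close> of places, where
  \<open>A\<close> and its complement give the same character. One step of the chain turns the character of \<open>A\<close>
  into that of the rotated set, times the probability that the chosen coordinate and the last place
  are on the same side of the rotated set. The Fourier transform of the law at time \<open>t\<close> is
  therefore an explicit product up to sign (\<open>transform_power\<close>).

  Upper bound. In \<open>n + 1\<close> steps every place becomes the last one exactly once, so the transform at a
  set of size \<open>w\<close> has absolute value
  \<open>((w - 1) / n)\<^sup>w ((n - w) / n)\<^bsup>n + 1 - w\<^esup>\<close> (\<open>prod_hold_full_turn\<close>). It vanishes for \<open>w = 1\<close> and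
  \<open>w = n\<close>, and for large \<open>n\<close> the main contribution comes from \<open>w = 2\<close> and
  \<open>w = n - 1\<close>. Summing the squares over
  all sets gives at most \<open>2 + 8 / n\<^sup>2\<close> (\<open>sum_full_turn_weights_le\<close>), where \<open>2\<close> is the contribution
  of the empty and the full set, the two names of the trivial character. Parseval and
  Cauchy-Schwarz turn this into the distance \<open>2 / n\<close>. Later steps only multiply the transform by
  further numbers in \<open>[0, 1]\<close>, so the bound persists.

  Lower bound. Start at \<open>0\<close> and let \<open>t < n\<close>. None of the first \<open>n - t\<close> coordinates of the state at
  time \<open>t\<close> has been at the last place of the word when a random bit was added there, so each of
  them has mean sign \<open>(1 - 1 / n)\<^sup>t \<ge> 1 / 3\<close>, and the signs of two of them are not positively correlated.
  The sum of these signs is of order \<open>n - t\<close> with variance at most \<open>n - t\<close>, while under the uniform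
  law it has mean \<open>0\<close> and the same bound on the variance. Chebyshev's inequality gives a total
  variation distance of at least \<open>1 - 72 / (n - t)\<close> (\<open>tv_from_zero_ge\<close>). So \<open>n - t\<close> only has to tend to
  infinity, and \<open>\<lfloor>\<surd>n\<rfloor>\<close> is a possible window.
\<close>

section \<open>Characters in cyclic coordinates\<close>

definition bit_sign :: "bit \<Rightarrow> real" where
  "bit_sign b = (if b = 0 then 1 else - 1)"

lemma bit_sign_add: "bit_sign (a + b) = bit_sign a * bit_sign b"
  by (cases "a = 0"; cases "b = 0") (auto simp: bit_sign_def)

lemma bit_sign_square [simp]: "bit_sign a * bit_sign a = 1"
  by (auto simp: bit_sign_def)

lemma abs_bit_sign [simp]: "\<bar>bit_sign a\<bar> = 1"
  by (auto simp: bit_sign_def)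

text \<open>
  The even-weight word of length \<open>n + 1\<close> on which the shift register acts as a rotation.
\<close>

definition cyc :: "bit list \<Rightarrow> bit list" where
  "cyc x = x @ [sum_list x]"

text \<open>
  A set \<open>A \<subseteq> {0, \<dots>, n}\<close> and its complement give the same character, so every character of
  \<open>{0,1}\<^sup>n\<close> occurs twice. This redundancy keeps the description invariant under rotation.
\<close>

definition chi :: "nat set \<Rightarrow> bit list \<Rightarrow> real" where
  "chi A x = (\<Prod>i\<in>A. bit_sign (cyc x ! i))"

definition rot :: "nat \<Rightarrow> nat \<Rightarrow> nat set \<Rightarrow> nat set" where
  "rot n s A = (\<lambda>i. (i + s) mod Suc n) ` A"

lemma cube_eq: "cube n = {x. set x \<subseteq> {0, 1} \<and> length x = n}"
  by (auto simp: cube_def)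

lemma finite_cube [simp]: "finite (cube n)"
  unfolding cube_eq by (rule finite_lists_length_eq) simp

lemma zero_in_cube: "replicate n 0 \<in> cube n"
  by (simp add: cube_def)

lemma card_cube: "card (cube n) = 2 ^ n"
  unfolding cube_eq by (subst card_lists_length_eq) (auto simp: numeral_2_eq_2)

lemma cube_nonempty [simp]: "cube n \<noteq> {}"
  using card_cube[of n] by auto

lemma length_cyc [simp]: "length (cyc x) = Suc (length x)"
  by (simp add: cyc_def)

lemma shift_in_cube: "x \<in> cube n \<Longrightarrow> 0 < n \<Longrightarrow> shift x \<in> cube n"
  by (auto simp: cube_def shift_def)

text \<open>
  The parity of \<open>(x\<^sub>2, \<dots>, x\<^sub>n, x\<^sub>1 + \<dots> + x\<^sub>n)\<close> is \<open>x\<^sub>1\<close>, since all other entries occur twice: the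
  entry that the register drops is the new parity.
\<close>

lemma cyc_shift:
  assumes "x \<noteq> []"
  shows "cyc (shift x) = rotate1 (cyc x)"
proof -
  obtain a y where x: "x = a # y"
    using assms by (cases x) auto
  have "sum_list y + (a + sum_list y) = a + (sum_list y + sum_list y)"
    by (simp only: ac_simps)
  also have "sum_list y + sum_list y = (0 :: bit)"
    by simp
  finally show ?thesis
    unfolding x cyc_def shift_def
    by (simp del: add_bit_eq_xor add: add.assoc)
qed

lemma chi_empty [simp]: "chi {} x = 1"
  by (simp add: chi_def)

lemma abs_chi [simp]: "\<bar>chi A x\<bar> = 1"
  by (simp add: chi_def abs_prod)

lemma chi_square [simp]: "(chi A x)\<^sup>2 = 1"
  by (metis abs_chi power2_abs one_power2)

lemma inj_on_rotation: "inj_on (\<lambda>i. (i + s) mod Suc n) {..n}"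
proof (rule inj_onI)
  fix i j assume ij: "i \<in> {..n}" "j \<in> {..n}" and eq: "(i + s) mod Suc n = (j + s) mod Suc n"
  have undo: "((k + s) mod Suc n + s * n) mod Suc n = k mod Suc n" for k
  proof -
    have "((k + s) mod Suc n + s * n) mod Suc n = (k + s * Suc n) mod Suc n"
      unfolding mod_add_left_eq by (simp add: algebra_simps)
    then show ?thesis
      by (simp only: mod_mult_self1)
  qed
  have "i mod Suc n = j mod Suc n"
    using eq undo by metis
  then show "i = j"
    using ij by simp
qed

lemma rot_subset: "rot n s A \<subseteq> {..n}"
  by (auto simp: rot_def less_Suc_eq_le[symmetric])

lemma card_rot: "A \<subseteq> {..n} \<Longrightarrow> card (rot n s A) = card A"
  unfolding rot_def by (rule card_image) (rule inj_on_subset[OF inj_on_rotation])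

lemma rot_rot: "rot n s (rot n t A) = rot n (t + s) A"
  by (auto simp: rot_def image_image mod_simps algebra_simps)

lemma rot_0: "A \<subseteq> {..n} \<Longrightarrow> rot n 0 A = A"
  by (force simp: rot_def image_def)

text \<open>
  The last place \<open>n\<close> visits the original places \<open>n - 1, n - 2, \<dots>, 0, n\<close> in the course of one turn.
\<close>

lemma top_mem_rot:
  assumes A: "A \<subseteq> {..n}" and "j < n"
  shows "n \<in> rot n (Suc j) A \<longleftrightarrow> n - Suc j \<in> A"
proof -
  have *: "(n - Suc j + Suc j) mod Suc n = n"
    using assms by simp
  have "n - Suc j \<in> {..n}"
    by simp
  then have "n - Suc j \<in> A \<longleftrightarrow> (n - Suc j + Suc j) mod Suc n \<in> rot n (Suc j) A"
    unfolding rot_def using inj_on_image_mem_iff[OF inj_on_rotation[of "Suc j" n] _ A] by blast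
  then show ?thesis
    using * by simp
qed

lemma top_mem_rot_full: "A \<subseteq> {..n} \<Longrightarrow> n \<in> rot n (Suc n) A \<longleftrightarrow> n \<in> A"
proof -
  assume A: "A \<subseteq> {..n}"
  have "rot n (Suc n) A = rot n 0 A"
    unfolding rot_def by (intro image_cong refl) (simp only: mod_add_self2 add_0_right)
  then show ?thesis
    using rot_0[OF A] by simp
qed

lemma chi_shift:
  assumes "x \<in> cube n" "0 < n" and A: "A \<subseteq> {..n}"
  shows "chi A (shift x) = chi (rot n 1 A) x"
proof -
  have len: "length x = n" "x \<noteq> []"
    using assms by (auto simp: cube_def)
  have "chi A (shift x) = (\<Prod>i\<in>A. bit_sign (cyc x ! ((i + 1) mod Suc n)))"
    unfolding chi_def using A len
    by (intro prod.cong refl) (auto simp: cyc_shift nth_rotate1)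
  also have "\<dots> = chi (rot n 1 A) x"
    unfolding chi_def rot_def
    by (subst prod.reindex[OF inj_on_subset[OF inj_on_rotation A]]) simp
  finally show ?thesis .
qed

lemma sum_list_flip: "i < length x \<Longrightarrow> sum_list (x[i := x ! i + 1]) = sum_list x + (1 :: bit)"
proof (induction x arbitrary: i)
  case (Cons a x)
  then show ?case
    by (cases i) (simp_all del: add_bit_eq_xor add: ac_simps)
qed simp

text \<open>
  Changing the entry at \<open>i\<close> also changes the parity at place \<open>n\<close>; the two changes cancel in the
  character exactly if \<open>A\<close> contains both places or neither.
\<close>

lemma chi_flip:
  assumes "x \<in> cube n" "i < n" and A: "A \<subseteq> {..n}"
  shows "chi A (x[i := x ! i + 1]) = chi A x * (if i \<in> A \<longleftrightarrow> n \<in> A then 1 else - 1)"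
proof -
  have len: "length x = n"
    using assms by (simp add: cube_def)
  have fin: "finite A"
    using A finite_subset by blast
  have "cyc (x[i := x ! i + 1]) ! j = cyc x ! j + (if j = i \<or> j = n then 1 else 0)"
    if "j \<in> A" for j
  proof -
    have "j \<le> n"
      using that A by auto
    then show ?thesis
      using len assms(2) unfolding cyc_def
      by (auto simp: nth_append sum_list_flip nth_list_update simp del: add_bit_eq_xor)
  qed
  then have "chi A (x[i := x ! i + 1]) =
      (\<Prod>j\<in>A. bit_sign (cyc x ! j) * ((if j = i then - 1 else 1) * (if j = n then - 1 else 1)))"
    unfolding chi_def using assms(2)
    by (intro prod.cong refl) (auto simp: bit_sign_add bit_sign_def simp del: add_bit_eq_xor)
  also have "\<dots> = chi A x * ((if i \<in> A then - 1 else 1) * (if n \<in> A then - 1 else 1))"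
    using fin by (simp add: prod.distrib chi_def prod.delta')
  finally show ?thesis
    by auto
qed

section \<open>Fourier transform of the chain\<close>

text \<open>
  The eigenvalue of the lazy walk at the character of \<open>A\<close>: the probability that flipping the chosen
  coordinate leaves that character unchanged. If flipping would negate it, the average over the
  random bit is \<open>0\<close>.
\<close>

definition hold :: "nat \<Rightarrow> nat set \<Rightarrow> real" where
  "hold n A = real (card {i\<in>{..<n}. i \<in> A \<longleftrightarrow> n \<in> A}) / real n"

lemma hold_nonneg: "0 \<le> hold n A"
  by (simp add: hold_def)

lemma hold_le_1: "hold n A \<le> 1"
proof -
  have "card {i\<in>{..<n}. i \<in> A \<longleftrightarrow> n \<in> A} \<le> card {..<n}"
    by (rule card_mono) auto
  then show ?thesis
    by (cases "n = 0") (auto simp: hold_def divide_simps)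
qed

lemma hold_eq:
  assumes A: "A \<subseteq> {..n}"
  shows "hold n A = real (if n \<in> A then card A - 1 else n - card A) / real n"
proof (cases "n \<in> A")
  case True
  then have "{i\<in>{..<n}. i \<in> A \<longleftrightarrow> n \<in> A} = A - {n}"
    using A by force
  then show ?thesis
    using True by (simp add: hold_def)
next
  case False
  then have "{i\<in>{..<n}. i \<in> A \<longleftrightarrow> n \<in> A} = {..<n} - A" "A \<subseteq> {..<n}"
    using A by (auto simp: nat_less_le)
  then show ?thesis
    using False by (simp add: hold_def card_Diff_subset finite_subset)
qed

lemma lazy_step_sum:
  assumes x: "x \<in> cube n" and n: "0 < n"
  shows "(\<Sum>z\<in>cube n. lazy_walk n x z * \<phi> z) =
    (\<Sum>i<n. (\<phi> x + \<phi> (x[i := x ! i + 1])) / 2) / real n"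
proof -
  let ?flip = "\<lambda>(i, R). x[i := x ! i + R]"
  have pair: "pair_pmf (pmf_of_set {..<n}) (pmf_of_set {0, 1 :: bit}) =
      pmf_of_set ({..<n} \<times> {0, 1})"
  proof (rule pmf_eqI)
    fix p :: "nat \<times> bit"
    have ne: "{..<n} \<noteq> {}" "{..<n} \<times> {0, 1 :: bit} \<noteq> {}"
      using n by auto
    show "pmf (pair_pmf (pmf_of_set {..<n}) (pmf_of_set {0, 1})) p =
        pmf (pmf_of_set ({..<n} \<times> {0, 1})) p"
      using n by (cases p) (simp add: pmf_pair pmf_of_set[OF ne(1)] pmf_of_set[OF ne(2)]
          card_cartesian_product indicator_def)
  qed
  have supp: "set_pmf (lazy_step n x) \<subseteq> cube n"
    using x by (auto simp: lazy_step_def cube_def)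
  have "(\<Sum>z\<in>cube n. lazy_walk n x z * \<phi> z) = (\<integral>z. \<phi> z \<partial>measure_pmf (lazy_step n x))"
    using supp by (subst integral_measure_pmf[of "cube n"]) (auto simp: lazy_walk_def)
  also have "\<dots> = (\<Sum>p\<in>{..<n} \<times> {0, 1}. \<phi> (?flip p)) / real (card ({..<n} \<times> {0, 1 :: bit}))"
    unfolding lazy_step_def pair integral_map_pmf
    by (subst integral_pmf_of_set) (use n in auto)
  also have "(\<Sum>p\<in>{..<n} \<times> {0, 1}. \<phi> (?flip p)) =
      (\<Sum>i<n. \<Sum>R\<in>{0, 1}. \<phi> (x[i := x ! i + R]))"
    unfolding sum.cartesian_product by (intro sum.cong refl) (simp add: case_prod_unfold)
  also have "\<dots> = (\<Sum>i<n. \<phi> x + \<phi> (x[i := x ! i + 1]))"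
    by (simp del: add_bit_eq_xor)
  also have "card ({..<n} \<times> {0, 1 :: bit}) = 2 * n"
    by (simp add: card_cartesian_product)
  finally show ?thesis
    by (simp add: sum_divide_distrib[symmetric])
qed

lemma lazy_step_chi:
  assumes x: "x \<in> cube n" and n: "0 < n" and A: "A \<subseteq> {..n}"
  shows "(\<Sum>z\<in>cube n. lazy_walk n x z * chi A z) = hold n A * chi A x"
proof -
  have "(\<Sum>i<n. (chi A x + chi A (x[i := x ! i + 1])) / 2) =
      (\<Sum>i<n. chi A x * (if i \<in> A \<longleftrightarrow> n \<in> A then 1 else 0))"
    using chi_flip[OF x _ A] by (intro sum.cong refl) (auto simp: field_simps)
  also have "\<dots> = chi A x * real (card {i\<in>{..<n}. i \<in> A \<longleftrightarrow> n \<in> A})"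
    by (simp add: sum_distrib_left[symmetric] sum.If_cases Int_def)
  finally show ?thesis
    by (simp add: lazy_step_sum[OF x n] hold_def)
qed

lemma Q1_sum:
  assumes n: "0 < n"
  shows "(\<Sum>y\<in>cube n. Q1 n x y * \<phi> y) = (\<Sum>z\<in>cube n. lazy_walk n x z * \<phi> (shift z))"
proof -
  have "(\<Sum>y\<in>cube n. Q1 n x y * \<phi> y) =
      (\<Sum>z\<in>cube n. \<Sum>y\<in>cube n. lazy_walk n x z * shift_matrix z y * \<phi> y)"
    unfolding Q1_def mat_mult_def sum_distrib_right by (rule sum.swap)
  also have "\<dots> = (\<Sum>z\<in>cube n. lazy_walk n x z * \<phi> (shift z))"
  proof (rule sum.cong[OF refl])
    fix z assume "z \<in> cube n"
    then have "(\<Sum>y\<in>cube n. (if y = shift z then lazy_walk n x z * \<phi> y else 0)) =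
        lazy_walk n x z * \<phi> (shift z)"
      using shift_in_cube[OF _ n] by simp
    then show "(\<Sum>y\<in>cube n. lazy_walk n x z * shift_matrix z y * \<phi> y) =
        lazy_walk n x z * \<phi> (shift z)"
      by (simp add: shift_matrix_def if_distrib if_distribR cong: if_cong)
  qed
  finally show ?thesis .
qed

lemma Q1_chi:
  assumes x: "x \<in> cube n" and n: "0 < n" and A: "A \<subseteq> {..n}"
  shows "(\<Sum>y\<in>cube n. Q1 n x y * chi A y) = hold n (rot n 1 A) * chi (rot n 1 A) x"
proof -
  have "(\<Sum>y\<in>cube n. Q1 n x y * chi A y) =
      (\<Sum>z\<in>cube n. lazy_walk n x z * chi (rot n 1 A) z)"
    unfolding Q1_sum[OF n] using chi_shift[OF _ n A] by (intro sum.cong refl) simp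
  then show ?thesis
    using lazy_step_chi[OF x n rot_subset] by simp
qed

text \<open>
  Each step moves the character of a set to that of the rotated set and multiplies it by an
  eigenvalue of the lazy walk, so the transform never mixes characters.
\<close>

lemma transform_power:
  assumes x: "x \<in> cube n" and n: "0 < n" and "A \<subseteq> {..n}"
  shows "(\<Sum>y\<in>cube n. mat_power n (Q1 n) t x y * chi A y) =
    chi (rot n t A) x * (\<Prod>j<t. hold n (rot n (Suc j) A))"
  using assms(3)
proof (induction t arbitrary: A)
  case 0
  have "(\<Sum>y\<in>cube n. (if x = y then 1 else 0) * chi A y) = chi A x"
    using x by (simp add: if_distrib if_distribR cong: if_cong)
  then show ?case
    using rot_0[OF 0] by simp
next
  case (Suc t)
  let ?B = "rot n 1 A"
  have "(\<Sum>y\<in>cube n. mat_power n (Q1 n) (Suc t) x y * chi A y) =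
      (\<Sum>z\<in>cube n. mat_power n (Q1 n) t x z * (\<Sum>y\<in>cube n. Q1 n z y * chi A y))"
    unfolding mat_power.simps mat_mult_def sum_distrib_right sum_distrib_left
    by (subst sum.swap) (simp add: mult.assoc)
  also have "\<dots> = hold n ?B * (\<Sum>z\<in>cube n. mat_power n (Q1 n) t x z * chi ?B z)"
    by (subst sum_distrib_left, intro sum.cong refl)
       (simp only: Q1_chi[OF _ n Suc.prems] mult.left_commute)
  also have "\<dots> = chi (rot n (Suc t) A) x *
      (hold n (rot n (Suc 0) A) * (\<Prod>j<t. hold n (rot n (Suc (Suc j)) A)))"
    using Suc.IH[OF rot_subset, of 1 A] by (simp add: rot_rot)
  finally show ?case
    by (simp add: prod.lessThan_Suc_shift del: prod.lessThan_Suc)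
qed

lemma mat_power_nonneg: "0 \<le> mat_power n (Q1 n) t x y"
  by (induction t arbitrary: y)
     (auto simp: mat_mult_def Q1_def lazy_walk_def shift_matrix_def intro!: sum_nonneg mult_nonneg_nonneg)

text \<open>
  The total mass is the transform at the empty set.
\<close>

lemma mat_power_sum_1:
  assumes "x \<in> cube n" "0 < n"
  shows "(\<Sum>y\<in>cube n. mat_power n (Q1 n) t x y) = 1"
proof -
  have "hold n {} = 1"
    using assms(2) by (simp add: hold_def)
  then show ?thesis
    using transform_power[OF assms, of "{}" t] by (simp add: rot_def)
qed

text \<open>
  In one full turn each place is the last one exactly once. Seen from a place of \<open>A\<close> there are
  \<open>card A - 1\<close> other places on the same side, and from a place outside \<open>A\<close> there are \<open>n - card A\<close>.
\<close>

lemma prod_hold_full_turn: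
  assumes A: "A \<subseteq> {..n}"
  shows "(\<Prod>j<Suc n. hold n (rot n (Suc j) A)) =
    (real (card A - 1) / n) ^ card A * (real (n - card A) / n) ^ (Suc n - card A)"
proof -
  define h where "h i = (if i \<in> A then real (card A - 1) / n else real (n - card A) / n)" for i
  have top: "hold n (rot n (Suc j) A) = h i" if "n \<in> rot n (Suc j) A \<longleftrightarrow> i \<in> A" for i j
    using that hold_eq[OF rot_subset, of n "Suc j" A] card_rot[OF A] by (simp add: h_def)
  have "(\<Prod>j<Suc n. hold n (rot n (Suc j) A)) = (\<Prod>j<n. h (n - Suc j)) * h n"
    using top_mem_rot[OF A] top_mem_rot_full[OF A] by (simp add: top)
  also have "\<dots> = (\<Prod>i<Suc n. h i)"
    by (simp add: prod.nat_diff_reindex)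
  also have "\<dots> = (\<Prod>i\<in>{..n} \<inter> A. real (card A - 1) / n) * (\<Prod>i\<in>{..n} - A. real (n - card A) / n)"
    unfolding h_def lessThan_Suc_atMost by (subst prod.If_cases) (auto simp: Diff_eq)
  also have "{..n} \<inter> A = A"
    using A by auto
  finally show ?thesis
    using A by (simp add: card_Diff_subset finite_subset[OF A])
qed

section \<open>Total variation distance\<close>

lemma unif_eq: "x \<in> cube n \<Longrightarrow> unif n x = 1 / 2 ^ n"
  by (simp add: unif_def card_cube)

lemma unif_nonneg: "0 \<le> unif n x"
  by (simp add: unif_def)

lemma unif_sum_1: "(\<Sum>x\<in>cube n. unif n x) = 1"
  by (simp add: unif_eq card_cube)

lemma tv_dist_ge:
  "B \<subseteq> cube n \<Longrightarrow> \<bar>sum \<mu> B - sum \<nu> B\<bar> \<le> tv_dist n \<mu> \<nu>"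
  unfolding tv_dist_def by (rule Max_ge) auto

lemma tv_dist_le:
  "(\<And>B. B \<subseteq> cube n \<Longrightarrow> \<bar>sum \<mu> B - sum \<nu> B\<bar> \<le> c) \<Longrightarrow> tv_dist n \<mu> \<nu> \<le> c"
  unfolding tv_dist_def by (subst Max_le_iff) auto

lemma tv_from_le_d: "x \<in> cube n \<Longrightarrow> tv_from n t x \<le> d n t"
  unfolding d_def by (rule Max_ge) auto

lemma d_le: "(\<And>x. x \<in> cube n \<Longrightarrow> tv_from n t x \<le> c) \<Longrightarrow> d n t \<le> c"
  unfolding d_def by (subst Max_le_iff) auto

lemma tv_from_nonneg: "0 \<le> tv_from n t x"
  using tv_dist_ge[of "{}" n "mat_power n (Q1 n) t x" "unif n"] by (simp add: tv_from_def)

lemma d_nonneg: "0 \<le> d n t"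
proof -
  obtain x where "x \<in> cube n"
    using cube_nonempty by blast
  then show ?thesis
    using tv_from_nonneg tv_from_le_d order_trans by blast
qed

lemma d_le_1:
  assumes n: "0 < n"
  shows "d n t \<le> 1"
proof (rule d_le, unfold tv_from_def, rule tv_dist_le)
  fix x B assume x: "x \<in> cube n" and B: "B \<subseteq> cube n"
  have "sum (mat_power n (Q1 n) t x) B \<le> 1" "sum (unif n) B \<le> 1"
    using sum_mono2[OF _ B, of "mat_power n (Q1 n) t x"] sum_mono2[OF _ B, of "unif n"]
      mat_power_sum_1[OF x n] unif_sum_1 mat_power_nonneg unif_nonneg by simp_all
  moreover have "0 \<le> sum (mat_power n (Q1 n) t x) B" "0 \<le> sum (unif n) B"
    by (simp_all add: sum_nonneg mat_power_nonneg unif_nonneg)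
  ultimately show "\<bar>sum (mat_power n (Q1 n) t x) B - sum (unif n) B\<bar> \<le> 1"
    by linarith
qed

section \<open>Upper bound\<close>

text \<open>
  Summing over all sets of places, not over one representative of each character, turns the sum
  into a product of factors \<open>1 + s\<^sub>i\<close>, and a factor vanishes as soon as \<open>x\<close> and \<open>y\<close> differ at a place.
  The double counting of characters accounts for \<open>2\<^bsup>n + 1\<^esup>\<close> in place of \<open>2\<^sup>n\<close>.
\<close>

lemma chi_orthogonal:
  assumes "x \<in> cube n" "y \<in> cube n"
  shows "(\<Sum>A\<in>Pow {..n}. chi A x * chi A y) = (if x = y then 2 ^ Suc n else 0)"
proof -
  let ?s = "\<lambda>i. bit_sign (cyc x ! i) * bit_sign (cyc y ! i)"
  have "(\<Sum>A\<in>Pow {..n}. chi A x * chi A y) = (\<Sum>A\<in>Pow {..n}. (\<Prod>i\<in>A. ?s i) * (\<Prod>i\<in>{..n} - A. 1))"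
    by (simp add: chi_def prod.distrib)
  also have "\<dots> = (\<Prod>i\<le>n. ?s i + 1)"
    by (rule prod_add[symmetric]) simp
  also have "\<dots> = (if x = y then 2 ^ Suc n else 0)"
  proof (cases "x = y")
    case False
    then obtain i where i: "i < n" "x ! i \<noteq> y ! i"
      using assms by (metis (mono_tags, lifting) cube_def mem_Collect_eq nth_equalityI)
    then have "?s i + 1 = 0"
      using assms by (auto simp: cyc_def nth_append cube_def bit_sign_def)
    moreover have "i \<in> {..n}"
      using i by simp
    ultimately have "(\<Prod>i\<le>n. ?s i + 1) = 0"
      by (intro prod_zero) blast+
    then show ?thesis
      using False by simp
  qed simp
  finally show ?thesis .
qed

lemma parseval:
  "(\<Sum>A\<in>Pow {..n}. (\<Sum>x\<in>cube n. g x * chi A x)\<^sup>2) = 2 ^ Suc n * (\<Sum>x\<in>cube n. (g x)\<^sup>2)"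
proof -
  have "(\<Sum>A\<in>Pow {..n}. (\<Sum>x\<in>cube n. g x * chi A x)\<^sup>2) =
      (\<Sum>A\<in>Pow {..n}. \<Sum>x\<in>cube n. \<Sum>y\<in>cube n. g x * g y * (chi A x * chi A y))"
    unfolding power2_eq_square sum_product by (simp add: mult_ac)
  also have "\<dots> = (\<Sum>x\<in>cube n. \<Sum>A\<in>Pow {..n}. \<Sum>y\<in>cube n. g x * g y * (chi A x * chi A y))"
    by (rule sum.swap)
  also have "\<dots> = (\<Sum>x\<in>cube n. \<Sum>y\<in>cube n. \<Sum>A\<in>Pow {..n}. g x * g y * (chi A x * chi A y))"
    by (intro sum.cong refl sum.swap)
  also have "\<dots> = (\<Sum>x\<in>cube n. \<Sum>y\<in>cube n. if x = y then 2 ^ Suc n * (g x)\<^sup>2 else 0)"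
    unfolding sum_distrib_left[symmetric]
    by (intro sum.cong refl) (auto simp: chi_orthogonal power2_eq_square)
  finally show ?thesis
    by (simp add: sum_distrib_left)
qed

text \<open>
  The Cauchy-Schwarz step from \<open>L\<^sup>1\<close> to \<open>L\<^sup>2\<close>. The summand \<open>2\<close> is the share of the empty and of the
  full set; by Parseval the remaining part is twice the squared \<open>L\<^sup>2\<close> distance, with respect to the
  uniform law, between the density of \<open>\<mu>\<close> and \<open>1\<close>.
\<close>

lemma tv_dist_unif_le:
  assumes \<mu>: "(\<Sum>x\<in>cube n. \<mu> x) = 1"
    and le: "(\<Sum>A\<in>Pow {..n}. (\<Sum>x\<in>cube n. \<mu> x * chi A x)\<^sup>2) \<le> 2 + 2 * \<eta>\<^sup>2" and "0 \<le> \<eta>"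
  shows "tv_dist n \<mu> (unif n) \<le> \<eta>"
proof (rule tv_dist_le)
  fix B assume B: "B \<subseteq> cube n"
  let ?g = "\<lambda>x. \<mu> x - unif n x"
  have sq: "2 ^ n * (\<Sum>x\<in>cube n. (\<mu> x)\<^sup>2) \<le> 1 + \<eta>\<^sup>2"
    using le parseval[where n = n and g = \<mu>] by simp
  have "(\<Sum>x\<in>cube n. (?g x)\<^sup>2) = (\<Sum>x\<in>cube n. (\<mu> x)\<^sup>2 - 2 / 2 ^ n * \<mu> x + (1 / 2 ^ n)\<^sup>2)"
    by (intro sum.cong refl) (simp add: unif_eq power2_diff)
  also have "\<dots> = (\<Sum>x\<in>cube n. (\<mu> x)\<^sup>2) - 1 / 2 ^ n"
    unfolding sum.distrib sum_subtractf sum_distrib_left[symmetric] \<mu>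
    by (simp add: card_cube power2_eq_square)
  finally have "2 ^ n * (\<Sum>x\<in>cube n. (?g x)\<^sup>2) = 2 ^ n * (\<Sum>x\<in>cube n. (\<mu> x)\<^sup>2) - 1"
    by (simp only: right_diff_distrib) simp
  then have "2 ^ n * (\<Sum>x\<in>cube n. (?g x)\<^sup>2) \<le> \<eta>\<^sup>2"
    using sq by linarith
  moreover have "(\<Sum>x\<in>cube n. \<bar>?g x\<bar>)\<^sup>2 \<le> 2 ^ n * (\<Sum>x\<in>cube n. (?g x)\<^sup>2)"
    using sum_squared_le_sum_of_squares[of "\<lambda>x. \<bar>?g x\<bar>" "cube n"] by (simp add: card_cube mult.commute)
  ultimately have "(\<Sum>x\<in>cube n. \<bar>?g x\<bar>) \<le> \<eta>"
    using \<open>0 \<le> \<eta>\<close> by (meson order_trans power2_le_imp_le)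
  moreover have "\<bar>sum \<mu> B - sum (unif n) B\<bar> \<le> (\<Sum>x\<in>B. \<bar>?g x\<bar>)"
    by (simp add: sum_subtractf[symmetric])
  moreover have "(\<Sum>x\<in>B. \<bar>?g x\<bar>) \<le> (\<Sum>x\<in>cube n. \<bar>?g x\<bar>)"
    by (rule sum_mono2[OF _ B]) auto
  ultimately show "\<bar>sum \<mu> B - sum (unif n) B\<bar> \<le> \<eta>"
    by linarith
qed

lemma binomial_term_le_1:
  fixes a b :: real
  assumes "0 \<le> a" "0 \<le> b" "a + b \<le> 1" "j \<le> N"
  shows "real (N choose j) * (a ^ j * b ^ (N - j)) \<le> 1"
proof -
  have "real (N choose j) * a ^ j * b ^ (N - j) \<le> (\<Sum>i\<le>N. real (N choose i) * a ^ i * b ^ (N - i))"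
    by (rule member_le_sum) (use assms in auto)
  also have "\<dots> = (a + b) ^ N"
    by (rule binomial_ring[symmetric])
  also have "\<dots> \<le> 1"
    using assms by (intro power_le_one) auto
  finally show ?thesis
    by (simp add: mult.assoc)
qed

text \<open>
  Pascal's rule reproduces the bound when both arguments are at least \<open>3\<close>; on the border \<open>a = 2\<close> or
  \<open>b = 2\<close> the binomial coefficient is quadratic and the bound is checked directly. The third factor
  on the left is what makes the following sum bounded.
\<close>

lemma binomial_ge_cubic:
  "2 \<le> a \<Longrightarrow> 2 \<le> b \<Longrightarrow> (a + b) * a * b \<le> 6 * ((a + b) choose a)"
proof (induction "a + b" arbitrary: a b)
  case (Suc k)
  have edge: "(2 + c) * 2 * c \<le> 6 * ((2 + c) choose 2)" for c :: nat
  proof -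
    have "2 * ((2 + c) choose 2) = (2 + c) * (1 + c)"
      by (simp add: choose_two)
    then have "6 * ((2 + c) choose 2) = 3 * ((2 + c) * (1 + c))"
      by linarith
    then show ?thesis
      by (simp add: algebra_simps)
  qed
  show ?case
  proof (cases "a = 2 \<or> b = 2")
    case True
    then show ?thesis
      using edge[of a] edge[of b] binomial_symmetric[of a "a + b"] by (auto simp: mult_ac add.commute)
  next
    case False
    define i j where "i = a - 3" and "j = b - 3"
    have ab: "a = i + 3" "b = j + 3"
      using False Suc.prems by (auto simp: i_def j_def)
    have k: "i + 2 + (j + 3) = i + j + 5" "i + 3 + (j + 2) = i + j + 5" "k = i + j + 5"
      using Suc.hyps(2) ab by auto
    have 1: "(i + j + 5) * (i + 2) * (j + 3) \<le> 6 * ((i + j + 5) choose (i + 2))"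
      using Suc.hyps(1)[of "i + 2" "j + 3"] unfolding k by simp
    have 2: "(i + j + 5) * (i + 3) * (j + 2) \<le> 6 * ((i + j + 5) choose (i + 3))"
      using Suc.hyps(1)[of "i + 3" "j + 2"] unfolding k by simp
    have "(a + b) choose a = ((i + j + 5) choose (i + 2)) + ((i + j + 5) choose (i + 3))"
    proof -
      have "a + b = Suc (i + j + 5)" "a = Suc (i + 2)" "Suc (i + 2) = i + 3"
        using ab by auto
      then show ?thesis
        by (metis binomial_Suc_Suc)
    qed
    moreover have "(a + b) * a * b \<le> (i + j + 5) * (i + 2) * (j + 3) + (i + j + 5) * (i + 3) * (j + 2)"
      unfolding ab by (simp add: algebra_simps)
    ultimately show ?thesis
      using 1 2 by linarith
  qed
qed auto

text \<open>
  The terms for \<open>m = 1\<close> and \<open>m = k - 1\<close> are below \<open>1\<close>; each of the other at most \<open>k\<close> nonzero terms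
  is at most \<open>6 / k\<close>.
\<close>

lemma sum_product_over_binomial_le:
  assumes k: "4 \<le> k"
  shows "(\<Sum>m\<le>k. real m * real (k - m) / real (k choose m)) \<le> 8"
proof -
  let ?f = "\<lambda>m. real m * real (k - m) / real (k choose m)"
  have inner: "?f m \<le> 6 / k" if m: "m \<in> {2..k - 2}" for m
  proof -
    have "m + (k - m) = k" "2 \<le> m" "2 \<le> k - m"
      using m k by auto
    then have "k * m * (k - m) \<le> 6 * (k choose m)"
      using binomial_ge_cubic[of m "k - m"] by simp
    then have "real k * real m * real (k - m) \<le> 6 * real (k choose m)"
      by (metis of_nat_le_iff of_nat_mult of_nat_numeral)
    moreover have "0 < k choose m"
      using \<open>m + (k - m) = k\<close> by (intro zero_less_binomial) simp
    ultimately show ?thesis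
      using k by (simp add: field_simps)
  qed
  have "{..k} = {0, 1, k - 1, k} \<union> {2..k - 2}"
    using k by auto
  then have "sum ?f {..k} = sum ?f {0, 1, k - 1, k} + sum ?f {2..k - 2}"
    using k by (subst sum.union_disjoint[symmetric]) auto
  also have "sum ?f {0, 1, k - 1, k} \<le> 2"
  proof -
    have "sum ?f {0, 1, k - 1, k} = ?f 1 + ?f (k - 1)"
      using k by simp
    moreover have "?f 1 \<le> 1"
      using k by simp
    moreover have "k choose (k - 1) = k"
      using k binomial_symmetric[of 1 k] by simp
    then have "?f (k - 1) \<le> 1"
      using k by simp
    ultimately show ?thesis
      by linarith
  qed
  also have "sum ?f {2..k - 2} \<le> real (card {2..k - 2}) * (6 / k)"
    by (rule sum_bounded_above) (rule inner)
  also have "\<dots> \<le> 6"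
    using k by (simp add: field_simps)
  finally show ?thesis
    by simp
qed

text \<open>
  One of the two factors in each square is absorbed by the binomial coefficient \<open>n + 1\<close> over \<open>w\<close>,
  because their product is a term of a binomial expansion of a number at most \<open>1\<close>. After splitting
  off \<open>m (k - m) / n\<^sup>2\<close>, with \<open>m = w - 1\<close> and \<open>k = n - 1\<close>, the same argument bounds the other
  factor by the reciprocal of \<open>k\<close> over \<open>m\<close>.
\<close>

lemma sum_full_turn_weights_le:
  assumes n: "5 \<le> n"
  shows "(\<Sum>w\<le>Suc n. real (Suc n choose w) *
      ((real (w - 1) / n) ^ w * (real (n - w) / n) ^ (Suc n - w))\<^sup>2) \<le> 2 + 8 / (real n)\<^sup>2"
proof -
  define h where "h w = real (Suc n choose w) *
      ((real (w - 1) / n) ^ w * (real (n - w) / n) ^ (Suc n - w))\<^sup>2" for w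
  define k where "k = n - 1"
  have nk: "n = Suc k" and k: "4 \<le> k"
    using n by (auto simp: k_def)
  have inner: "h (Suc m) \<le> real m * real (k - m) / real (k choose m) / (real n)\<^sup>2" if m: "m \<le> k" for m
  proof -
    define a b where "a = real m / n" and "b = real (k - m) / n"
    have "a + b = real k / n"
      using m by (simp add: a_def b_def add_divide_distrib[symmetric] of_nat_diff)
    then have ab: "0 \<le> a" "0 \<le> b" "a + b \<le> 1"
      using nk by (auto simp: a_def b_def)
    have "h (Suc m) = real (Suc n choose Suc m) * (a ^ Suc m * b ^ (Suc n - Suc m)) *
        (a ^ Suc m * b ^ (Suc n - Suc m))"
      by (simp add: h_def a_def b_def nk power2_eq_square)
    also have "\<dots> \<le> 1 * (a ^ Suc m * b ^ (Suc n - Suc m))"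
      using m nk ab by (intro mult_right_mono binomial_term_le_1) auto
    also have "\<dots> = a * b * (a ^ m * b ^ (k - m))"
      using m nk by (simp add: Suc_diff_le)
    also have "\<dots> \<le> a * b * (1 / real (k choose m))"
    proof -
      have "0 < k choose m"
        using m by simp
      then have "a ^ m * b ^ (k - m) \<le> 1 / real (k choose m)"
        using binomial_term_le_1[OF ab m] by (simp add: field_simps)
      then show ?thesis
        using ab by (intro mult_left_mono) auto
    qed
    finally show ?thesis
      by (simp add: a_def b_def power2_eq_square field_simps)
  qed
  have "(\<Sum>w\<le>Suc n. h w) = h 0 + (\<Sum>m\<le>k. h (Suc m)) + h (Suc n)"
    unfolding nk by (subst sum.atMost_Suc, subst sum.atMost_Suc_shift) simp
  (* w = 0 and w = n + 1: the convention 0 ^ 0 = 1 gives the trivial character its value 1 *)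
  also have "h 0 + (\<Sum>m\<le>k. h (Suc m)) + h (Suc n) = 2 + (\<Sum>m\<le>k. h (Suc m))"
    using n by (auto simp: h_def)
  also have "(\<Sum>m\<le>k. h (Suc m)) \<le> (\<Sum>m\<le>k. real m * real (k - m) / real (k choose m) / (real n)\<^sup>2)"
    by (rule sum_mono) (use inner in auto)
  also have "\<dots> \<le> 8 / (real n)\<^sup>2"
    unfolding sum_divide_distrib[symmetric]
    by (rule divide_right_mono[OF sum_product_over_binomial_le[OF k]]) simp
  finally show ?thesis
    by (simp add: h_def)
qed

lemma sum_Pow_by_card:
  fixes h :: "nat \<Rightarrow> real"
  assumes "finite S"
  shows "(\<Sum>A\<in>Pow S. h (card A)) = (\<Sum>w\<le>card S. real (card S choose w) * h w)"
proof -
  have "(\<Sum>A\<in>Pow S. h (card A)) = (\<Sum>w\<le>card S. \<Sum>A\<in>{A\<in>Pow S. card A = w}. h (card A))"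
    using assms by (intro sum.group[symmetric]) (auto intro: card_mono)
  also have "\<dots> = (\<Sum>w\<le>card S. real (card S choose w) * h w)"
    using n_subsets[OF assms] by (intro sum.cong refl) simp
  finally show ?thesis .
qed

text \<open>
  The transform at time \<open>n + 1\<close> is known exactly up to sign, and the eigenvalues of later steps are
  at most \<open>1\<close>.
\<close>

lemma d_after_full_turn_le:
  assumes n: "5 \<le> n" and t: "Suc n \<le> t"
  shows "d n t \<le> 2 / real n"
proof (rule d_le, unfold tv_from_def, rule tv_dist_unif_le)
  fix x assume x: "x \<in> cube n"
  have n0: "0 < n"
    using n by simp
  show "(\<Sum>y\<in>cube n. mat_power n (Q1 n) t x y) = 1"
    by (rule mat_power_sum_1[OF x n0])
  define h where "h w = ((real (w - 1) / n) ^ w * (real (n - w) / n) ^ (Suc n - w))\<^sup>2" for w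
  have "(\<Sum>y\<in>cube n. mat_power n (Q1 n) t x y * chi A y)\<^sup>2 \<le> h (card A)" if "A \<in> Pow {..n}" for A
  proof -
    have A: "A \<subseteq> {..n}"
      using that by simp
    have "(\<Prod>j<t. hold n (rot n (Suc j) A)) =
        (\<Prod>j\<in>{..<t} - {..<Suc n}. hold n (rot n (Suc j) A)) * (\<Prod>j<Suc n. hold n (rot n (Suc j) A))"
      using t by (intro prod.subset_diff) auto
    also have "\<dots> \<le> (\<Prod>j<Suc n. hold n (rot n (Suc j) A))"
      by (intro mult_left_le_one_le prod_nonneg prod_le_1) (auto simp: hold_nonneg hold_le_1)
    finally have "(\<Prod>j<t. hold n (rot n (Suc j) A)) \<le> (\<Prod>j<Suc n. hold n (rot n (Suc j) A))" .
    then have "(\<Prod>j<t. hold n (rot n (Suc j) A))\<^sup>2 \<le> (\<Prod>j<Suc n. hold n (rot n (Suc j) A))\<^sup>2"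
      by (intro power_mono prod_nonneg) (auto simp: hold_nonneg)
    then show ?thesis
      unfolding transform_power[OF x n0 A] prod_hold_full_turn[OF A] h_def by (simp add: power_mult_distrib)
  qed
  then have "(\<Sum>A\<in>Pow {..n}. (\<Sum>y\<in>cube n. mat_power n (Q1 n) t x y * chi A y)\<^sup>2) \<le>
      (\<Sum>A\<in>Pow {..n}. h (card A))"
    by (rule sum_mono)
  also have "\<dots> \<le> 2 + 2 * (2 / real n)\<^sup>2"
    using sum_Pow_by_card[of "{..n}" h] sum_full_turn_weights_le[OF n] by (simp add: h_def power_divide)
  finally show "(\<Sum>A\<in>Pow {..n}. (\<Sum>y\<in>cube n. mat_power n (Q1 n) t x y * chi A y)\<^sup>2) \<le>
      2 + 2 * (2 / real n)\<^sup>2" .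
qed simp

section \<open>Lower bound\<close>

text \<open>
  The number of zeros minus the number of ones among the first \<open>m\<close> coordinates, for \<open>m\<close> at most
  the length of the list.
\<close>

definition bias :: "nat \<Rightarrow> bit list \<Rightarrow> real" where
  "bias m x = (\<Sum>p<m. chi {p} x)"

text \<open>
  The off-diagonal terms of the second moment are at most the corresponding terms of the squared
  mean, so only the \<open>m\<close> diagonal terms contribute to the variance.
\<close>

lemma bias_moments:
  assumes sum1: "(\<Sum>x\<in>cube n. \<mu> x) = 1"
    and single: "\<And>p. p < m \<Longrightarrow> (\<Sum>x\<in>cube n. \<mu> x * chi {p} x) = b"
    and double: "\<And>p q. p < m \<Longrightarrow> q < m \<Longrightarrow> p \<noteq> q \<Longrightarrow> (\<Sum>x\<in>cube n. \<mu> x * chi {p, q} x) \<le> b\<^sup>2"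
  shows "(\<Sum>x\<in>cube n. \<mu> x * (bias m x - m * b)\<^sup>2) \<le> m"
proof -
  have mean: "(\<Sum>x\<in>cube n. \<mu> x * bias m x) = m * b"
  proof -
    have "(\<Sum>x\<in>cube n. \<mu> x * bias m x) = (\<Sum>p<m. \<Sum>x\<in>cube n. \<mu> x * chi {p} x)"
      unfolding bias_def sum_distrib_left by (rule sum.swap)
    then show ?thesis
      using single by simp
  qed
  have sq: "(\<Sum>x\<in>cube n. \<mu> x * (bias m x)\<^sup>2) \<le> m + (m * b)\<^sup>2"
  proof -
    have "(\<Sum>x\<in>cube n. \<mu> x * (bias m x)\<^sup>2) =
        (\<Sum>x\<in>cube n. \<Sum>p<m. \<Sum>q<m. \<mu> x * (chi {p} x * chi {q} x))"
      unfolding bias_def power2_eq_square sum_product by (simp add: sum_distrib_left)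
    also have "\<dots> = (\<Sum>p<m. \<Sum>x\<in>cube n. \<Sum>q<m. \<mu> x * (chi {p} x * chi {q} x))"
      by (rule sum.swap)
    also have "\<dots> = (\<Sum>p<m. \<Sum>q<m. \<Sum>x\<in>cube n. \<mu> x * (chi {p} x * chi {q} x))"
      by (intro sum.cong refl sum.swap)
    also have "\<dots> \<le> (\<Sum>p<m. \<Sum>q<m. (if p = q then 1 else 0) + b\<^sup>2)"
    proof (intro sum_mono)
      fix p q assume "p \<in> {..<m}" "q \<in> {..<m}"
      then show "(\<Sum>x\<in>cube n. \<mu> x * (chi {p} x * chi {q} x)) \<le> (if p = q then 1 else 0) + b\<^sup>2"
        using sum1 double[of p q] by (cases "p = q") (simp_all add: chi_def)
    qed
    also have "\<dots> = m + (m * b)\<^sup>2"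
      by (simp add: sum.distrib power2_eq_square algebra_simps)
    finally show ?thesis .
  qed
  have "(\<Sum>x\<in>cube n. \<mu> x * (bias m x - m * b)\<^sup>2) =
      (\<Sum>x\<in>cube n. \<mu> x * (bias m x)\<^sup>2 - 2 * (m * b) * (\<mu> x * bias m x) + (m * b)\<^sup>2 * \<mu> x)"
    by (intro sum.cong refl) (simp add: power2_diff algebra_simps)
  also have "\<dots> = (\<Sum>x\<in>cube n. \<mu> x * (bias m x)\<^sup>2) - (m * b)\<^sup>2"
    unfolding sum.distrib sum_subtractf sum_distrib_left[symmetric] mean sum1
    by (simp add: power2_eq_square)
  finally show ?thesis
    using sq by simp
qed

lemma chebyshev_sum:
  fixes \<mu> Z :: "'a \<Rightarrow> real"
  assumes "finite S" "B \<subseteq> S" and nonneg: "\<And>x. 0 \<le> \<mu> x"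
    and var: "(\<Sum>x\<in>S. \<mu> x * (Z x)\<^sup>2) \<le> v" and far: "\<And>x. x \<in> B \<Longrightarrow> a \<le> \<bar>Z x\<bar>" and "0 < a"
  shows "sum \<mu> B \<le> v / a\<^sup>2"
proof -
  have "a\<^sup>2 * sum \<mu> B = (\<Sum>x\<in>B. \<mu> x * a\<^sup>2)"
    by (simp add: sum_distrib_right[symmetric] mult.commute)
  also have "\<dots> \<le> (\<Sum>x\<in>B. \<mu> x * (Z x)\<^sup>2)"
  proof (intro sum_mono mult_left_mono nonneg)
    fix x assume "x \<in> B"
    then show "a\<^sup>2 \<le> (Z x)\<^sup>2"
      using far[of x] \<open>0 < a\<close> by (simp add: abs_le_square_iff[symmetric])
  qed
  also have "\<dots> \<le> (\<Sum>x\<in>S. \<mu> x * (Z x)\<^sup>2)"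
    using assms by (intro sum_mono2) auto
  finally show ?thesis
    using var \<open>0 < a\<close> by (simp add: field_simps)
qed

text \<open>
  Flipping the entry at a place \<open>p\<close> of \<open>A\<close> pairs the points with opposite signs, as the parity place
  is not in \<open>A\<close>.
\<close>

lemma sum_chi_eq_0:
  assumes A: "A \<subseteq> {..<n}" and "p \<in> A"
  shows "(\<Sum>x\<in>cube n. chi A x) = 0"
proof -
  let ?flip = "\<lambda>x :: bit list. x[p := x ! p + 1]"
  have p: "p < n" "n \<notin> A" "A \<subseteq> {..n}"
    using assms by auto
  have inv: "?flip (?flip x) = x" if "x \<in> cube n" for x
  proof -
    have "x ! p + 1 + 1 = x ! p"
      by (simp only: add.assoc) simp
    then show ?thesis
      using that p by (simp add: cube_def del: add_bit_eq_xor)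
  qed
  have closed: "?flip x \<in> cube n" if "x \<in> cube n" for x
    using that by (simp add: cube_def)
  have "(\<Sum>x\<in>cube n. chi A x) = (\<Sum>x\<in>cube n. chi A (?flip x))"
    by (rule sum.reindex_bij_witness[of _ ?flip ?flip])
       (simp_all only: inv closed)
  also have "\<dots> = - (\<Sum>x\<in>cube n. chi A x)"
    unfolding sum_negf[symmetric]
    using chi_flip[OF _ p(1,3)] p assms by (intro sum.cong refl) simp
  finally show ?thesis
    by simp
qed

text \<open>
  During the first \<open>t\<close> steps the last place visits only the places \<open>n - 1, \<dots>, n - t\<close> of the final
  state. Hence the rotated copies of \<open>A\<close> avoid the last place, and every step contributes the same
  factor.
\<close>

lemma transform_untouched:
  assumes n: "0 < n" and t: "t \<le> n" and A: "A \<subseteq> {..<n - t}"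
  shows "(\<Sum>x\<in>cube n. mat_power n (Q1 n) t (replicate n 0) x * chi A x) =
    (real (n - card A) / real n) ^ t"
proof -
  have A': "A \<subseteq> {..n}"
    using A by auto
  have "hold n (rot n (Suc j) A) = real (n - card A) / real n" if "j < t" for j
  proof -
    have "n \<notin> rot n (Suc j) A"
      using top_mem_rot[OF A', of j] A that t by auto
    then show ?thesis
      using hold_eq[OF rot_subset, of n "Suc j" A] card_rot[OF A'] by simp
  qed
  moreover have "chi (rot n t A) (replicate n 0) = 1"
    unfolding chi_def
  proof (rule prod.neutral, rule ballI)
    fix i assume "i \<in> rot n t A"
    then have "i \<le> n"
      using rot_subset by auto
    then show "bit_sign (cyc (replicate n 0) ! i) = 1"
      by (auto simp: cyc_def nth_append bit_sign_def sum_list_replicate)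
  qed
  ultimately show ?thesis
    using transform_power[OF zero_in_cube n A', of t] by simp
qed

lemma one_minus_inverse_power_ge:
  assumes "t < n"
  shows "1 / 3 \<le> (1 - 1 / real n) ^ t"
proof (cases "t = 0")
  case False
  define k where "k = n - 1"
  have k: "n = Suc k" "0 < k" "t \<le> k"
    using assms False by (auto simp: k_def)
  have "(1 + 1 / real k) ^ k \<le> exp 1"
    using exp_ge_one_plus_x_over_n_power_n[where x = 1 and n = k] k by auto
  then have *: "(1 + 1 / real k) ^ k \<le> 3"
    using exp_le by linarith
  have "1 - 1 / real n = 1 / (1 + 1 / real k)"
    using k by (simp add: field_simps)
  then have "(1 - 1 / real n) ^ k = 1 / (1 + 1 / real k) ^ k"
    by (simp add: power_one_over)
  also have "\<dots> \<ge> 1 / 3"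
    using * by (intro divide_left_mono) (auto intro!: zero_less_power add_pos_nonneg)
  finally have "1 / 3 \<le> (1 - 1 / real n) ^ k" .
  also have "\<dots> \<le> (1 - 1 / real n) ^ t"
    using k by (intro power_decreasing) auto
  finally show ?thesis .
qed simp

text \<open>
  The event that separates the two laws is that the bias of the first \<open>n - t\<close> coordinates exceeds
  half its mean under the chain. Chebyshev's inequality bounds each of the two error
  probabilities by \<open>36 / (n - t)\<close>.
\<close>

lemma tv_from_zero_ge:
  assumes t: "t < n"
  shows "1 - 72 / real (n - t) \<le> tv_from n t (replicate n 0)"
proof -
  define m where "m = n - t"
  define b where "b = (1 - 1 / real n) ^ t"
  define \<mu> where "\<mu> = mat_power n (Q1 n) t (replicate n 0)"
  have n: "0 < n" and m: "0 < m" "m \<le> n"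
    using t by (auto simp: m_def)
  have b: "1 / 3 \<le> b"
    unfolding b_def by (rule one_minus_inverse_power_ge[OF t])
  have \<mu>1: "sum \<mu> (cube n) = 1"
    unfolding \<mu>_def by (rule mat_power_sum_1[OF zero_in_cube n])
  have var\<mu>: "(\<Sum>x\<in>cube n. \<mu> x * (bias m x - m * b)\<^sup>2) \<le> m"
  proof (rule bias_moments[OF \<mu>1])
    fix p assume "p < m"
    then show "(\<Sum>x\<in>cube n. \<mu> x * chi {p} x) = b"
      using transform_untouched[OF n, of t "{p}"] t n
      by (simp add: \<mu>_def b_def m_def of_nat_diff diff_divide_distrib)
  next
    fix p q assume pq: "p < m" "q < m" "p \<noteq> q"
    then have n2: "2 \<le> n"
      using m by linarith
    have "(\<Sum>x\<in>cube n. \<mu> x * chi {p, q} x) = (1 - 2 / real n) ^ t"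
      using transform_untouched[OF n, of t "{p, q}"] t n2 pq
      by (simp add: \<mu>_def m_def of_nat_diff diff_divide_distrib)
    (* 1 - 2 / n \<le> (1 - 1 / n)^2: the two signs are not positively correlated *)
    also have "\<dots> \<le> ((1 - 1 / real n)\<^sup>2) ^ t"
      using n2 by (intro power_mono) (auto simp: power2_eq_square field_simps)
    also have "\<dots> = b\<^sup>2"
      by (simp add: b_def power_mult[symmetric] mult.commute)
    finally show "(\<Sum>x\<in>cube n. \<mu> x * chi {p, q} x) \<le> b\<^sup>2" .
  qed
  have unif_chi: "(\<Sum>x\<in>cube n. unif n x * chi A x) = 0" if "A \<subseteq> {..<n}" "p \<in> A" for A p
    using sum_chi_eq_0[OF that] by (simp add: unif_eq sum_divide_distrib[symmetric])
  have varu: "(\<Sum>x\<in>cube n. unif n x * (bias m x - real m * 0)\<^sup>2) \<le> m"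
  proof (rule bias_moments[OF unif_sum_1])
    fix p assume "p < m"
    then show "(\<Sum>x\<in>cube n. unif n x * chi {p} x) = 0"
      using m by (intro unif_chi[of _ p]) auto
  next
    fix p q assume "p < m" "q < m"
    then have "(\<Sum>x\<in>cube n. unif n x * chi {p, q} x) = 0"
      using m by (intro unif_chi[of _ p]) auto
    then show "(\<Sum>x\<in>cube n. unif n x * chi {p, q} x) \<le> 0\<^sup>2"
      by simp
  qed
  define a where "a = m * b / 2"
  have a: "0 < a"
    using b m by (simp add: a_def)
  have "m / a\<^sup>2 \<le> 36 / m"
  proof -
    have "m / a\<^sup>2 = 4 / (m * b\<^sup>2)"
      using m b by (simp add: a_def power2_eq_square field_simps)
    also have "\<dots> \<le> 4 / (m * (1 / 3)\<^sup>2)"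
      using m b by (intro divide_left_mono mult_left_mono power_mono mult_pos_pos) auto
    finally show ?thesis
      by (simp add: power2_eq_square)
  qed
  define B where "B = {x \<in> cube n. a \<le> bias m x}"
  have "sum \<mu> (cube n - B) \<le> m / a\<^sup>2"
  proof (rule chebyshev_sum[OF _ _ _ var\<mu> _ a])
    fix x assume "x \<in> cube n - B"
    then have "bias m x < a"
      by (auto simp: B_def)
    moreover have "m * b = a + a"
      by (simp add: a_def)
    ultimately show "a \<le> \<bar>bias m x - m * b\<bar>"
      by linarith
  qed (auto simp: \<mu>_def mat_power_nonneg)
  moreover have "sum (unif n) B \<le> m / a\<^sup>2"
    by (rule chebyshev_sum[OF _ _ _ varu _ a]) (auto simp: B_def unif_nonneg)
  moreover have "sum \<mu> (cube n - B) = 1 - sum \<mu> B"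
    using \<mu>1 by (subst sum_diff) (auto simp: B_def)
  moreover have "\<bar>sum \<mu> B - sum (unif n) B\<bar> \<le> tv_from n t (replicate n 0)"
    unfolding tv_from_def \<mu>_def by (rule tv_dist_ge) (auto simp: B_def)
  ultimately show ?thesis
    using \<open>m / a\<^sup>2 \<le> 36 / m\<close> unfolding m_def[symmetric] by (simp add: field_simps)
qed

section \<open>Cutoff\<close>

lemma lower_bound_at_powr_window:
  assumes \<alpha>: "0 < \<alpha>" "\<alpha> < 1"
  shows "\<exists>\<epsilon> :: nat \<Rightarrow> real. \<epsilon> \<in> o[at_top](\<lambda>_. 1) \<and>
    (\<forall>n\<ge>1. let t = nat \<lfloor>real n - real n powr \<alpha>\<rfloor>
            in d n t \<ge> tv_from n t (replicate n 0) \<and> tv_from n t (replicate n 0) \<ge> 1 - \<epsilon> n)"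
proof (intro exI conjI allI impI)
  show "(\<lambda>n. 72 / real n powr \<alpha>) \<in> o[at_top](\<lambda>_. 1)"
    using \<alpha> by real_asymp
next
  fix n :: nat assume n: "1 \<le> n"
  define t where "t = nat \<lfloor>real n - real n powr \<alpha>\<rfloor>"
  have "real n powr \<alpha> \<le> real n powr 1"
    using n \<alpha> by (intro powr_mono) auto
  then have "real t \<le> real n - real n powr \<alpha>"
    using n by (simp add: t_def)
  moreover have pos: "1 \<le> real n powr \<alpha>"
    using n \<alpha> by (simp add: ge_one_powr_ge_zero)
  ultimately have t: "t < n" "real n powr \<alpha> \<le> real (n - t)"
    by linarith+
  have "72 / real (n - t) \<le> 72 / real n powr \<alpha>"
    using t pos by (intro divide_left_mono mult_pos_pos) auto
  then have "1 - 72 / real n powr \<alpha> \<le> tv_from n t (replicate n 0)"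
    using tv_from_zero_ge[OF t(1)] by (rule order_trans[OF diff_left_mono])
  then show "let t = nat \<lfloor>real n - real n powr \<alpha>\<rfloor>
      in d n t \<ge> tv_from n t (replicate n 0) \<and> tv_from n t (replicate n 0) \<ge> 1 - 72 / real n powr \<alpha>"
    unfolding t_def Let_def using tv_from_le_d[OF zero_in_cube] by blast
qed

lemma d_after_window_tendsto:
  assumes "\<And>n. 1 \<le> n \<Longrightarrow> 0 < w n"
  shows "(\<lambda>n. d n (n + w n)) \<longlonglongrightarrow> 0"
proof (rule tendsto_sandwich[where f = "\<lambda>_. 0"])
  show "\<forall>\<^sub>F n in sequentially. d n (n + w n) \<le> 2 / real n"
    using eventually_ge_at_top[of 5]
  proof eventually_elim
    case (elim n)
    then show ?case
      using assms[of n] by (intro d_after_full_turn_le) auto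
  qed
  show "(\<lambda>n. 2 / real n) \<longlonglongrightarrow> 0"
    by real_asymp
qed (simp_all add: d_nonneg)

text \<open>
  Any window that tends to infinity is wide enough for the lower bound.
\<close>

lemma d_before_window_tendsto:
  assumes w: "\<And>n. 1 \<le> n \<Longrightarrow> 0 < w n \<and> w n \<le> n" and lim: "filterlim w at_top sequentially"
  shows "(\<lambda>n. d n (n - w n)) \<longlonglongrightarrow> 1"
proof (rule tendsto_sandwich)
  show "\<forall>\<^sub>F n in sequentially. 1 - 72 / real (w n) \<le> d n (n - w n)"
    using eventually_ge_at_top[of 1]
  proof eventually_elim
    case (elim n)
    then show ?case
      using w[OF elim] tv_from_zero_ge[of "n - w n" n] tv_from_le_d[OF zero_in_cube, of n "n - w n"]
      by simp
  qed
  show "\<forall>\<^sub>F n in sequentially. d n (n - w n) \<le> 1"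
    using eventually_ge_at_top[of 1] by eventually_elim (simp add: d_le_1)
  have "filterlim (\<lambda>n. real (w n)) at_infinity sequentially"
    by (intro filterlim_at_top_imp_at_infinity filterlim_compose[OF filterlim_real_sequentially lim])
  then have "(\<lambda>n. 1 - 72 / real (w n)) \<longlonglongrightarrow> 1 - 0"
    by (intro tendsto_diff tendsto_const tendsto_divide_0[OF tendsto_const])
  then show "(\<lambda>n. 1 - 72 / real (w n)) \<longlonglongrightarrow> 1"
    by simp
qed simp

lemma cutoff_window_sqrt:
  assumes \<delta>: "0 < \<delta>"
  shows "\<exists>w :: nat \<Rightarrow> nat.
    (\<forall>n\<ge>1. 0 < w n \<and> real (w n) \<le> real n powr (1 / 2 + \<delta>)) \<and>
    (\<lambda>n. real (w n)) \<in> o[at_top](\<lambda>n. real n) \<and>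
    limsup (\<lambda>n. ereal (d n (n + w n))) = 0 \<and>
    liminf (\<lambda>n. ereal (d n (n - w n))) = 1"
proof -
  define w where "w n = nat \<lfloor>sqrt (real n)\<rfloor>" for n
  have pos: "0 < w n" if "1 \<le> n" for n
    using that by (simp add: w_def)
  have le_sqrt: "real (w n) \<le> sqrt (real n)" for n
    by (simp add: w_def)
  have le_n: "w n \<le> n" if "1 \<le> n" for n
  proof -
    have "sqrt (real n) \<le> real n"
      using that by (intro real_le_lsqrt) (auto simp: power2_eq_square)
    then show ?thesis
      using le_sqrt[of n] by linarith
  qed
  have le_powr: "real (w n) \<le> real n powr (1 / 2 + \<delta>)" if "1 \<le> n" for n
  proof -
    have "sqrt (real n) = real n powr (1 / 2)"
      by (simp add: powr_half_sqrt)
    also have "\<dots> \<le> real n powr (1 / 2 + \<delta>)"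
      using that \<delta> by (intro powr_mono) auto
    finally show ?thesis
      using le_sqrt[of n] by linarith
  qed
  have top: "filterlim w at_top sequentially"
    unfolding w_def by real_asymp
  have small: "(\<lambda>n. real (w n)) \<in> o[at_top](\<lambda>n. real n)"
    unfolding w_def by real_asymp
  have "(\<lambda>n. d n (n + w n)) \<longlonglongrightarrow> 0"
    by (rule d_after_window_tendsto) (rule pos)
  then have "limsup (\<lambda>n. ereal (d n (n + w n))) = 0"
    by (intro lim_imp_Limsup) (auto simp: zero_ereal_def)
  moreover have "(\<lambda>n. d n (n - w n)) \<longlonglongrightarrow> 1"
    by (rule d_before_window_tendsto[OF _ top]) (use pos le_n in auto)
  then have "liminf (\<lambda>n. ereal (d n (n - w n))) = 1"
    by (intro lim_imp_Liminf) (auto simp: one_ereal_def)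
  ultimately show ?thesis
    using pos le_powr small by blast
qed

theorem theorem1:
  shows "(\<forall>n\<ge>5. d n (n + 1) \<le> 2 / real n)
    \<and> (\<forall>\<alpha>::real. 1 / 2 < \<alpha> \<longrightarrow> \<alpha> < 1 \<longrightarrow>
         (\<exists>\<epsilon> :: nat \<Rightarrow> real. \<epsilon> \<in> o[at_top](\<lambda>_. 1) \<and>
            (\<forall>n\<ge>1. let t = nat \<lfloor>real n - real n powr \<alpha>\<rfloor>
                    in d n t \<ge> tv_from n t (replicate n 0) \<and>
                       tv_from n t (replicate n 0) \<ge> 1 - \<epsilon> n)))
    \<and> (\<forall>\<delta>::real. 0 < \<delta> \<longrightarrow>
         (\<exists>w :: nat \<Rightarrow> nat.
            (\<forall>n\<ge>1. 0 < w n \<and> real (w n) \<le> real n powr (1 / 2 + \<delta>)) \<and>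
            (\<lambda>n. real (w n)) \<in> o[at_top](\<lambda>n. real n) \<and>
            limsup (\<lambda>n. ereal (d n (n + w n))) = 0 \<and>
            liminf (\<lambda>n. ereal (d n (n - w n))) = 1))"
proof (intro conjI allI impI)
  fix n :: nat assume "5 \<le> n"
  then show "d n (n + 1) \<le> 2 / real n"
    by (intro d_after_full_turn_le) auto
next
  fix \<alpha> :: real assume "1 / 2 < \<alpha>" "\<alpha> < 1"
  then show "\<exists>\<epsilon> :: nat \<Rightarrow> real. \<epsilon> \<in> o[at_top](\<lambda>_. 1) \<and>
      (\<forall>n\<ge>1. let t = nat \<lfloor>real n - real n powr \<alpha>\<rfloor>
              in d n t \<ge> tv_from n t (replicate n 0) \<and>
                 tv_from n t (replicate n 0) \<ge> 1 - \<epsilon> n)"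
    by (intro lower_bound_at_powr_window) auto
next
  fix \<delta> :: real assume "0 < \<delta>"
  then show "\<exists>w :: nat \<Rightarrow> nat.
      (\<forall>n\<ge>1. 0 < w n \<and> real (w n) \<le> real n powr (1 / 2 + \<delta>)) \<and>
      (\<lambda>n. real (w n)) \<in> o[at_top](\<lambda>n. real n) \<and>
      limsup (\<lambda>n. ereal (d n (n + w n))) = 0 \<and>
      liminf (\<lambda>n. ereal (d n (n - w n))) = 1"
    by (rule cutoff_window_sqrt)
qed

end
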